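(* Let $n\in\mathbb N$, $a\in\mathbb R\setminus(0,1)$ and $\mathbf m\in(\mathbb R\setminus(0,1))^k$ with $k\ge1$. Writing $M(h(x))(n)=\int_0^1x^nh(x)\,dx$, we have $$M(H_{a,\mathbf m}(x))(n)=\begin{cases} \frac{(1-a^{n+1})H_{a,\mathbf m}(1)}{n+1}-\frac{a^n}{n+1}\sum_{i=0}^n\frac{M(H_{\mathbf m}(x))(i)}{a^i},&a<0,\\[1mm] \frac{H_{0,\mathbf m}(1)}{n+1}-\frac1{n+1}M(H_{\mathbf m}(x))(n),&a=0,\\[1mm] \frac1{n+1}\sum_{i=0}^nM(H_{\mathbf m}(x))(i),&a=1,\\[1mm] \frac{(1-a^{n+1})H_{a,\mathbf m}(1)}{n+1}+\frac{a^n}{n+1}\sum_{i=0}^n\frac{M(H_{\mathbf m}(x))(i)}{a^i},&a>1, \end{cases}$$ where the arising constants are finite.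
   Context: $\mathbb N=\{1,2,\dots\}$. Generalized harmonic polylogarithms: for $a\in\mathbb R$ put $f_0(x)=\frac1x$ and $f_a(x)=\frac{1}{|a|-\operatorname{sign}(a)\,x}$ for $a\ne0$. For real $m_1,\dots,m_w$ and $0<x<\min_{m_i>0}m_i$ (no upper bound if no $m_i$ is positive), $H(x)=1$ for the empty index vector, $H_{m_1,\ldots,m_w}(x)=\frac{1}{w!}(\log x)^w$ if all $m_i=0$, and otherwise $H_{m_1,\ldots,m_w}(x)=\int_0^x f_{m_1}(y)H_{m_2,\ldots,m_w}(y)\,dy$. $H_{\mathbf m}(1)$ means $\lim_{x\to1^-}H_{\mathbf m}(x)$; $H_{a,\mathbf m}$ is the polylogarithm with $a$ prepended to the index vector $\mathbf m$. *)

theory Defs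
  imports "HOL-Analysis.Analysis"
begin

definition hpl_kernel :: "real \<Rightarrow> real \<Rightarrow> real" where
  "hpl_kernel a x = (if a = 0 then 1 / x else 1 / (\<bar>a\<bar> - sgn a * x))"

text \<open>
  The value \<open>hpl ms x\<close> is meaningful for \<open>0 < x\<close> with \<open>x < m\<close> for every positive \<open>m \<in> set ms\<close>;
  outside this range it is an artefact of totality.  If no index lies in the open interval from
  0 to 1, the range contains that interval, and the definitions below depend only on the values there.
\<close>

fun hpl :: "real list \<Rightarrow> real \<Rightarrow> real" where
  "hpl [] x = 1"
| "hpl (m # ms) x =
     (if \<forall>b \<in> set (m # ms). b = 0
      then (ln x) ^ length (m # ms) / fact (length (m # ms))
      else (LBINT y=0..x. hpl_kernel m y * hpl ms y))"

text \<open>The value at 1 is the left-sided limit; \<open>hpl_at_1\<close> is unspecified when this limit does not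
  exist in the reals, which is what \<open>hpl_at_1_finite\<close> excludes.\<close>

definition hpl_at_1 :: "real list \<Rightarrow> real" where
  "hpl_at_1 ms = Lim (at_left 1) (hpl ms)"

definition hpl_at_1_finite :: "real list \<Rightarrow> bool" where
  "hpl_at_1_finite ms \<longleftrightarrow> (\<exists>l. (hpl ms \<longlongrightarrow> l) (at_left 1))"

definition mellin :: "(real \<Rightarrow> real) \<Rightarrow> nat \<Rightarrow> real" where
  "mellin h n = (LBINT x=0..1. x ^ n * h x)"

text \<open>Rules out the default value 0 of the Lebesgue integral of a non-integrable function.\<close>

definition mellin_finite :: "(real \<Rightarrow> real) \<Rightarrow> nat \<Rightarrow> bool" where
  "mellin_finite h n \<longleftrightarrow> interval_lebesgue_integrable lborel 0 1 (\<lambda>x. x ^ n * h x)"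

end

theory Submission
  imports Defs
begin

text \<open>
  If no index lies in \<open>{0<..<1}\<close>, then \<open>\<bar>H x\<bar> \<le> C / (sqrt x * sqrt (1 - x))\<close> on that interval, and
  \<open>\<bar>H x\<bar> \<le> C * sqrt x / sqrt (1 - x)\<close> unless all indices vanish.  Both bounds survive integration
  against a kernel: the integrand is at most \<open>C / (sqrt x * sqrt (1 - x) * (1 - x))\<close>, which
  is the derivative of \<open>2 * C * sqrt x / sqrt (1 - x)\<close>.  This makes all the Mellin transforms finite
  and controls the boundary terms of the integration by parts whose antiderivative of \<open>x ^ n\<close> is
  \<open>(x ^ (n + 1) - a ^ (n + 1)) / (n + 1)\<close>; its root at \<open>a\<close> cancels the pole of the kernel and leaves
  the geometric sum.
\<close>

section \<open>Integrable majorants on the unit interval\<close>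

lemma set_integrable_Ioo_bound:
  fixes f g :: "real \<Rightarrow> real"
  assumes "set_integrable lborel {a<..<b} g"
    and "continuous_on {a<..<b} f"
    and "\<And>x. x \<in> {a<..<b} \<Longrightarrow> \<bar>f x\<bar> \<le> g x"
  shows "set_integrable lborel {a<..<b} f"
proof (rule set_integrable_bound[OF assms(1)])
  show "set_borel_measurable lborel {a<..<b} f"
    unfolding set_borel_measurable_def
    using borel_measurable_continuous_on_indicator[OF _ assms(2)] by simp
  show "AE x in lborel. x \<in> {a<..<b} \<longrightarrow> norm (f x) \<le> norm (g x)"
    using assms(3) by (intro AE_I2) force
qed

lemma lborel_interval_Ioo:
  fixes f :: "real \<Rightarrow> real"
  assumes "0 \<le> x"
  shows "(LBINT y=0..x. f y) = (LINT y:{0<..<x}|lborel. f y)"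
  using assms by (simp add: interval_integral_Ioo zero_ereal_def)

text \<open>The antiderivative \<open>2 * sqrt y / sqrt (1 - y)\<close> tends to 0 at 0, and
  nonnegativity of the integrand yields integrability together with the value. The endpoint stays
  below 1 because the singularity there is not integrable.\<close>

lemma singular_kernel_integral:
  assumes "0 < x" "x < 1"
  shows "set_integrable lborel {0<..<x} (\<lambda>y. 1 / (sqrt y * sqrt (1 - y) * (1 - y)))"
    and "(LINT y:{0<..<x}|lborel. 1 / (sqrt y * sqrt (1 - y) * (1 - y))) = 2 * sqrt x / sqrt (1 - x)"
proof -
  let ?f = "\<lambda>y::real. 1 / (sqrt y * sqrt (1 - y) * (1 - y))"
  let ?F = "\<lambda>y::real. 2 * sqrt y / sqrt (1 - y)"
  have D: "DERIV ?F y :> ?f y" if "0 < y" "y < 1" for y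
  proof -
    \<comment> \<open>With these identities the derivative check becomes rational in
      \<open>sqrt y\<close> and \<open>sqrt (1 - y)\<close>.\<close>
    have "sqrt y * sqrt y = y" "sqrt (1 - y) * sqrt (1 - y) = 1 - y" using that by auto
    moreover have "sqrt y > 0" "sqrt (1 - y) > 0" using that by auto
    ultimately show ?thesis
      using that
      by (auto intro!: derivative_eq_intros simp: field_simps)
  qed
  have c: "isCont ?f y" if "0 < y" "y < 1" for y
    using that by (auto intro!: continuous_intros)
  have 0: "((?F \<circ> real_of_ereal) \<longlongrightarrow> 0) (at_right (ereal 0))"
    unfolding ereal_tendsto_simps by (auto intro!: tendsto_eq_intros)
  have 1: "((?F \<circ> real_of_ereal) \<longlongrightarrow> ?F x) (at_left (ereal x))"
    unfolding ereal_tendsto_simps using assms by (auto intro!: tendsto_eq_intros)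
  note * = interval_integral_FTC_nonneg[of "ereal 0" "ereal x" ?F ?f, OF _ D c _ 0 1]
  show "set_integrable lborel {0<..<x} ?f"
    using *(1) assms by simp
  show "(LINT y:{0<..<x}|lborel. ?f y) = ?F x"
    using *(2) assms lborel_interval_Ioo[of x ?f] by (simp add: zero_ereal_def)
qed

text \<open>The antiderivative \<open>arcsin (2 * y - 1)\<close> is continuous on the closed
  interval, so the inverse square root singularities at both ends are harmless.\<close>

lemma arcsine_kernel_integrable:
  "set_integrable lborel {0<..<1} (\<lambda>y::real. 1 / (sqrt y * sqrt (1 - y)))"
proof -
  let ?f = "\<lambda>y::real. 1 / (sqrt y * sqrt (1 - y))"
  let ?F = "\<lambda>y::real. arcsin (2 * y - 1)"
  have D: "DERIV ?F y :> ?f y" if "0 < y" "y < 1" for y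
  proof -
    have "1 - (2 * y - 1)\<^sup>2 = 4 * (y * (1 - y))" by (simp add: power2_eq_square algebra_simps)
    then have "sqrt (1 - (2 * y - 1)\<^sup>2) = 2 * (sqrt y * sqrt (1 - y))"
      by (simp add: real_sqrt_mult)
    moreover have "DERIV ?F y :> inverse (sqrt (1 - (2 * y - 1)\<^sup>2)) * 2"
      by (rule DERIV_chain2[OF DERIV_arcsin]) (use that in \<open>auto intro!: derivative_eq_intros\<close>)
    ultimately show ?thesis by (simp add: inverse_eq_divide)
  qed
  have c: "isCont ?f y" if "0 < y" "y < 1" for y
    using that by (auto intro!: continuous_intros)
  have co: "continuous_on {0..1} ?F"
    by (intro continuous_intros) auto
  have 0: "((?F \<circ> real_of_ereal) \<longlongrightarrow> ?F 0) (at_right (ereal 0))"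
    unfolding ereal_tendsto_simps
    by (rule continuous_on_Icc_at_rightD[OF co]) simp
  have 1: "((?F \<circ> real_of_ereal) \<longlongrightarrow> ?F 1) (at_left (ereal 1))"
    unfolding ereal_tendsto_simps
    by (rule continuous_on_Icc_at_leftD[OF co]) simp
  have "set_integrable lborel (einterval (ereal 0) (ereal 1)) ?f"
    by (rule interval_integral_FTC_nonneg(1)[OF _ D c _ 0 1]) auto
  then show ?thesis unfolding einterval_eq .
qed

section \<open>Integrals from 0 with a varying endpoint\<close>

text \<open>This carries regularity and growth through one integration. The majorant is integrable
  up to each point below 1 but not up to 1, hence the interior endpoint.\<close>

lemma integral_from_zero:
  fixes f :: "real \<Rightarrow> real"
  assumes "continuous_on {0<..<1} f"
    and bd: "\<And>y. y \<in> {0<..<1} \<Longrightarrow> \<bar>f y\<bar> \<le> C / (sqrt y * sqrt (1 - y) * (1 - y))"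
    and x: "x \<in> {0<..<1}"
  shows "((\<lambda>x::real. LBINT y=0..x. f y) has_real_derivative f x) (at x)"
    and "\<bar>LBINT y=0..x. f y\<bar> \<le> 2 * C * sqrt x / sqrt (1 - x)"
proof -
  let ?g = "\<lambda>y::real. C * (1 / (sqrt y * sqrt (1 - y) * (1 - y)))"
  have g: "set_integrable lborel {0<..<z} ?g" if "z \<in> {0<..<1}" for z
    using singular_kernel_integral(1)[of z] that by (intro set_integrable_mult_right) auto
  have int: "set_integrable lborel {0<..<z} f" if "z \<in> {0<..<1}" for z
    by (rule set_integrable_Ioo_bound[OF g[OF that]])
       (use that bd in \<open>auto intro!: continuous_on_subset[OF assms(1)]\<close>)
  \<comment> \<open>Passing to the gauge integral gives access to the derivative of the indefinite
    integral at a point of continuity.\<close>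
  have eq: "(LBINT y=0..z. f y) = integral {0..z} f" if "z \<in> {0<..<1}" for z
    using that int[OF that] lborel_interval_Ioo[of z f]
    by (simp add: set_borel_integral_eq_integral integral_open_interval_real)
  \<comment> \<open>A point between \<open>x\<close> and 1 makes \<open>x\<close> interior to
    \<open>{0..b}\<close>, so the derivative within that interval is two-sided.\<close>
  define b where "b = (x + 1) / 2"
  have b: "x < b" "b < 1" using x by (auto simp: b_def)
  have "f integrable_on {0..b}"
    using set_borel_integral_eq_integral(1)[OF int[of b]] b x
    by (simp add: integrable_on_open_interval_real)
  moreover have "isCont f x"
    using assms(1) x by (simp add: continuous_on_eq_continuous_at)
  ultimately have "((\<lambda>u. integral {0..u} f) has_vector_derivative f x) (at x within {0..b})"
    using integral_has_vector_derivative_continuous_at[of f 0 b x "{}"] x b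
    by (simp add: continuous_at_imp_continuous_at_within)
  then have "((\<lambda>u. integral {0..u} f) has_real_derivative f x) (at x)"
    using x b by (simp add: has_real_derivative_iff_has_vector_derivative at_within_Icc_at)
  then show "((\<lambda>x::real. LBINT y=0..x. f y) has_real_derivative f x) (at x)"
    by (rule DERIV_cong_ev[THEN iffD1, rotated -1])
       (use eq x in \<open>auto intro!: eventually_nhds_in_open[of "{0<..<1}", THEN eventually_mono]\<close>)
  have "\<bar>LBINT y=0..x. f y\<bar> \<le> (LINT y:{0<..<x}|lborel. \<bar>f y\<bar>)"
    using x lborel_interval_Ioo[of x f] set_integral_norm_bound[OF int[OF x]] by simp
  also have "\<dots> \<le> (LINT y:{0<..<x}|lborel. ?g y)"
    using x bd by (intro set_integral_mono set_integrable_abs int g) auto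
  also have "\<dots> = C * (2 * sqrt x / sqrt (1 - x))"
    unfolding set_integral_mult_right using singular_kernel_integral(2)[of x] x by simp
  finally show "\<bar>LBINT y=0..x. f y\<bar> \<le> 2 * C * sqrt x / sqrt (1 - x)"
    by (simp add: mult_ac)
qed

text \<open>Without the extra factor \<open>1 / (1 - y)\<close> the majorant is integrable up to 1,
  so the indefinite integral is continuous there. This supplies limits at 1 when the leading index
  is not 1.\<close>

lemma integral_from_zero_tendsto_at_left_1:
  fixes f :: "real \<Rightarrow> real"
  assumes "continuous_on {0<..<1} f"
    and "\<And>y. y \<in> {0<..<1} \<Longrightarrow> \<bar>f y\<bar> \<le> C / (sqrt y * sqrt (1 - y))"
  shows "((\<lambda>x::real. LBINT y=0..x. f y) \<longlongrightarrow> integral {0..1} f) (at_left 1)"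
proof -
  have int: "set_integrable lborel {0<..<1} f"
    by (rule set_integrable_Ioo_bound[OF set_integrable_mult_right[OF arcsine_kernel_integrable, of C]])
       (use assms in auto)
  then have "f integrable_on {0..1}"
    using set_borel_integral_eq_integral(1)[OF int] by (simp add: integrable_on_open_interval_real)
  then have "((\<lambda>x. integral {0..x} f) \<longlongrightarrow> integral {0..1} f) (at_left 1)"
    using continuous_on_Icc_at_leftD[OF indefinite_integral_continuous_1] by fastforce
  moreover have "(LBINT y=0..z. f y) = integral {0..z} f" if "z \<in> {0<..<1}" for z
  proof -
    have "set_integrable lborel {0<..<z} f"
      using that by (intro set_integrable_subset[OF int]) auto
    then show ?thesis
      using that lborel_interval_Ioo[of z f]
      by (simp add: set_borel_integral_eq_integral integral_open_interval_real)
  qed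
  moreover have "eventually (\<lambda>z::real. z \<in> {0<..<1}) (at_left 1)"
    by (rule eventually_at_leftI[of 0]) auto
  ultimately show ?thesis
    by (metis (mono_tags, lifting) Lim_transform_eventually eventually_mono)
qed

section \<open>Pointwise bounds for logarithms and kernels\<close>

text \<open>For \<open>t = - ln x / 2\<close>, one term of the nonnegative exponential series gives
  \<open>t ^ k / fact k \<le> exp t = 1 / sqrt x\<close>. Undoing the halving costs
  \<open>2 ^ k\<close>; the factor \<open>1 / sqrt (1 - x) \<ge> 1\<close> only adapts the bound to
  the common form.\<close>

lemma abs_ln_power_le:
  assumes "0 < x" "x < 1"
  shows "\<bar>ln x ^ k / fact k\<bar> \<le> 2 ^ k / (sqrt x * sqrt (1 - x))"
proof -
  define t where "t = - ln x / 2"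
  have t: "t \<ge> 0" using assms by (simp add: t_def)
  have s: "summable (\<lambda>n. t ^ n /\<^sub>R fact n)" using summable_exp_generic by blast
  have "(\<Sum>n\<in>{k}. t ^ n /\<^sub>R fact n) \<le> exp t"
    unfolding exp_def by (rule sum_le_suminf[OF s]) (use t in auto)
  then have 1: "t ^ k / fact k \<le> exp t" by (simp add: field_simps)
  have "t = - ln (sqrt x)" using assms by (simp add: t_def ln_sqrt)
  then have "exp t = 1 / sqrt x" using assms by (simp add: exp_minus inverse_eq_divide)
  moreover have "\<dots> \<le> 1 / (sqrt x * sqrt (1 - x))"
    using assms by (intro divide_left_mono) (auto intro: mult_left_le)
  ultimately have "2 ^ k * (t ^ k / fact k) \<le> 2 ^ k * (1 / (sqrt x * sqrt (1 - x)))"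
    using 1 by (intro mult_left_mono) auto
  moreover have "\<bar>ln x ^ k / fact k\<bar> = 2 ^ k * (t ^ k / fact k)"
    using assms by (simp add: t_def power_abs abs_mult power_divide flip: power_mult_distrib)
  ultimately show ?thesis by simp
qed

text \<open>For \<open>a \<ge> 1\<close> the worst case is the simple pole at 1, as
  \<open>a - x \<ge> 1 - x\<close>; for \<open>a < 0\<close> the kernel
  \<open>1 / (\<bar>a\<bar> + x)\<close> is at most \<open>1 / \<bar>a\<bar>\<close>. The constant
  covers both.\<close>

lemma abs_hpl_kernel_le:
  assumes "a \<noteq> 0" "a \<notin> {0<..<1}" "x \<in> {0<..<1}"
  shows "\<bar>hpl_kernel a x\<bar> \<le> (1 + 1 / \<bar>a\<bar>) / (1 - x)"
proof (cases "a > 0")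
  case True
  then have "1 - x \<le> a - x" "0 < 1 - x" using assms by auto
  then have "1 / (a - x) \<le> 1 / (1 - x)" by (intro divide_left_mono mult_pos_pos) auto
  also have "\<dots> \<le> (1 + 1 / \<bar>a\<bar>) / (1 - x)" using assms by (intro divide_right_mono) auto
  finally show ?thesis using True assms by (simp add: hpl_kernel_def)
next
  case False
  then have "a < 0" using assms by auto
  then have "\<bar>hpl_kernel a x\<bar> = 1 / (\<bar>a\<bar> + x)" using assms by (simp add: hpl_kernel_def)
  also have "\<dots> \<le> 1 / \<bar>a\<bar>" using assms by (intro divide_left_mono) (auto intro!: mult_pos_pos)
  also have "\<dots> \<le> (1 + 1 / \<bar>a\<bar>) / 1" by simp
  also have "\<dots> \<le> (1 + 1 / \<bar>a\<bar>) / (1 - x)"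
    using assms by (intro divide_left_mono) auto
  finally show ?thesis .
qed

text \<open>With \<open>a = 1\<close> excluded, the pole keeps a distance of at least
  \<open>a - 1\<close> or \<open>\<bar>a\<bar>\<close> from the interval, according to the sign of
  \<open>a\<close>.\<close>

lemma abs_hpl_kernel_le_const:
  assumes "a \<noteq> 0" "a \<noteq> 1" "a \<notin> {0<..<1}" "x \<in> {0<..<1}"
  shows "\<bar>hpl_kernel a x\<bar> \<le> 1 / \<bar>a\<bar> + 1 / \<bar>a - 1\<bar>"
proof (cases "a > 0")
  case True
  then have "a > 1" using assms by auto
  then have "\<bar>hpl_kernel a x\<bar> \<le> 1 / \<bar>a - 1\<bar>"
    using assms by (auto simp: hpl_kernel_def intro!: divide_left_mono mult_pos_pos)
  then show ?thesis using True by (simp add: add_increasing)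
next
  case False
  then have "a < 0" using assms by auto
  then have "\<bar>hpl_kernel a x\<bar> = 1 / (\<bar>a\<bar> + x)" using assms by (simp add: hpl_kernel_def)
  also have "\<dots> \<le> 1 / \<bar>a\<bar>" using assms by (intro divide_left_mono) (auto intro!: mult_pos_pos)
  finally show ?thesis by (simp add: add_increasing2)
qed

lemma continuous_on_hpl_kernel:
  assumes "a \<notin> {0<..<1}"
  shows "continuous_on {0<..<1} (hpl_kernel a)"
proof -
  have "\<bar>a\<bar> - sgn a * x \<noteq> 0" if "a \<noteq> 0" "x \<in> {0<..<1}" for x
    using assms that by (cases "a > 0") auto
  then show ?thesis
    unfolding hpl_kernel_def by (cases "a = 0") (auto intro!: continuous_intros)
qed

section \<open>Regularity and growth of polylogarithms\<close>

text \<open>The second bound is what allows index 0 to be prepended: its decay at 0 absorbs the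
  kernel \<open>1 / x\<close>. It is conditional because the constant 1 and the powers of the
  logarithm do not vanish at 0.\<close>

definition hpl_dominated :: "real list \<Rightarrow> real \<Rightarrow> bool" where
  "hpl_dominated ms C \<longleftrightarrow> C \<ge> 0 \<and> (\<forall>x\<in>{0<..<1}. \<bar>hpl ms x\<bar> \<le> C / (sqrt x * sqrt (1 - x)) \<and>
     ((\<exists>b\<in>set ms. b \<noteq> 0) \<longrightarrow> \<bar>hpl ms x\<bar> \<le> C * sqrt x / sqrt (1 - x)))"

text \<open>Since \<open>sqrt x = x / sqrt x\<close> and \<open>x \<le> 1\<close>, the decaying
  bound implies the other one.\<close>

lemma hpl_dominatedI:
  assumes "C \<ge> 0" "\<And>x. x \<in> {0<..<1} \<Longrightarrow> \<bar>hpl ms x\<bar> \<le> C * sqrt x / sqrt (1 - x)"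
  shows "hpl_dominated ms C"
  unfolding hpl_dominated_def
proof (intro conjI ballI impI)
  fix x :: real assume x: "x \<in> {0<..<1}"
  have "C * sqrt x / sqrt (1 - x) = C * x / (sqrt x * sqrt (1 - x))"
    using x by (simp add: field_simps)
  also have "\<dots> \<le> C / (sqrt x * sqrt (1 - x))"
    using x assms(1) by (intro divide_right_mono) (auto intro: mult_left_le)
  finally show "\<bar>hpl ms x\<bar> \<le> C / (sqrt x * sqrt (1 - x))"
    using assms(2)[OF x] by linarith
qed (use assms in auto)

text \<open>Dividing \<open>sqrt x\<close> by \<open>x\<close> leaves \<open>1 / sqrt x\<close>, so
  the integrand stays below a majorant integrable at both ends.\<close>

lemma hpl_integrand_zero_bound:
  assumes "hpl_dominated ms C" "\<exists>b\<in>set ms. b \<noteq> 0" "x \<in> {0<..<1}"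
  shows "\<bar>hpl_kernel 0 x * hpl ms x\<bar> \<le> C / (sqrt x * sqrt (1 - x))"
proof -
  have "\<bar>hpl_kernel 0 x * hpl ms x\<bar> = \<bar>hpl ms x\<bar> / x"
    using assms by (simp add: hpl_kernel_def abs_mult)
  also have "\<dots> \<le> C * sqrt x / sqrt (1 - x) / x"
    using assms by (intro divide_right_mono) (auto simp: hpl_dominated_def)
  also have "\<dots> = C / (sqrt x * sqrt (1 - x))"
    using assms(3) by (simp add: field_simps)
  finally show ?thesis .
qed

text \<open>A nonzero index costs at most a factor \<open>1 / (1 - x)\<close>; index 0 uses the
  decay at 0, available because the nonzero index then lies in \<open>ms\<close>.\<close>

lemma hpl_integrand_bound:
  assumes dom: "hpl_dominated ms C" and nz: "\<exists>b\<in>set (a # ms). b \<noteq> 0" and a: "a \<notin> {0<..<1}"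
    and x: "x \<in> {0<..<1}"
  shows "\<bar>hpl_kernel a x * hpl ms x\<bar> \<le> (1 + 1 / \<bar>a\<bar>) * C / (sqrt x * sqrt (1 - x) * (1 - x))"
proof (cases "a = 0")
  case True
  have "\<bar>hpl_kernel a x * hpl ms x\<bar> \<le> C / (sqrt x * sqrt (1 - x))"
    using hpl_integrand_zero_bound[OF dom _ x] nz True by simp
  also have "\<dots> \<le> C / (sqrt x * sqrt (1 - x) * (1 - x))"
    using x dom by (intro divide_left_mono) (auto simp: hpl_dominated_def intro: mult_left_le)
  \<comment> \<open>By convention \<open>1 / 0 = 0\<close>, so the factor
    \<open>1 + 1 / \<bar>a\<bar>\<close> equals 1 here.\<close>
  finally show ?thesis using True by simp
next
  case False
  have "\<bar>hpl_kernel a x\<bar> * \<bar>hpl ms x\<bar> \<le> (1 + 1 / \<bar>a\<bar>) / (1 - x) * (C / (sqrt x * sqrt (1 - x)))"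
    using abs_hpl_kernel_le[OF False a x] dom x
    by (intro mult_mono) (auto simp: hpl_dominated_def)
  then show ?thesis by (simp add: abs_mult mult_ac)
qed

text \<open>The formula for the tail includes the empty one, where it reads
  \<open>ln x ^ 0 / fact 0 = 1\<close>.\<close>

lemma hpl_Cons_all_zero:
  assumes "\<forall>b\<in>set (m # ms). b = 0"
  shows "hpl (m # ms) = (\<lambda>x. ln x ^ Suc (length ms) / fact (Suc (length ms)))"
    and "hpl ms = (\<lambda>x. ln x ^ length ms / fact (length ms))"
  using assms by (auto simp: fun_eq_iff, cases ms) auto

lemma hpl_Cons_not_all_zero:
  assumes "\<exists>b\<in>set (m # ms). b \<noteq> 0"
  shows "hpl (m # ms) = (\<lambda>x. LBINT y=0..x. hpl_kernel m y * hpl ms y)"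
  using assms by (auto simp: fun_eq_iff)

text \<open>Domination and continuity of the tail are hypotheses so that the result can serve inside
  the induction that establishes them.\<close>

lemma hpl_Cons_derivative_aux:
  assumes m: "m \<notin> {0<..<1}" and dom: "hpl_dominated ms C"
    and co: "continuous_on {0<..<1} (hpl ms)"
    and x: "x \<in> {0<..<1}"
  shows "(hpl (m # ms) has_real_derivative hpl_kernel m x * hpl ms x) (at x)"
proof (cases "\<forall>b\<in>set (m # ms). b = 0")
  case True
  let ?k = "length ms"
  have "((\<lambda>x. ln x ^ Suc ?k / fact (Suc ?k)) has_real_derivative
     (1 + real ?k) * (1 / x * ln x ^ ?k) / fact (Suc ?k)) (at x)"
    using x by (intro DERIV_cdivide DERIV_power_Suc DERIV_ln_divide) auto
  moreover have "(1 + real ?k) * (1 / x * ln x ^ ?k) / fact (Suc ?k) = 1 / x * (ln x ^ ?k / fact ?k)"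
    unfolding fact_Suc by simp
  ultimately have "((\<lambda>x. ln x ^ Suc ?k / fact (Suc ?k)) has_real_derivative
     1 / x * (ln x ^ ?k / fact ?k)) (at x)"
    by (simp only:)
  then show ?thesis
    unfolding hpl_Cons_all_zero(1)[OF True] unfolding hpl_Cons_all_zero(2)[OF True]
    using True by (simp add: hpl_kernel_def del: fact_Suc)
next
  case False
  then have nz: "\<exists>b\<in>set (m # ms). b \<noteq> 0" by blast
  show ?thesis
    unfolding hpl_Cons_not_all_zero[OF nz]
    by (intro integral_from_zero(1)[OF _ hpl_integrand_bound[OF dom nz m]] x
          continuous_on_mult continuous_on_hpl_kernel co m)
qed

text \<open>The two properties need a joint induction: both, for the tail, enter the derivative and
  the growth estimate of the longer vector, and the derivative gives its continuity.\<close>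

lemma hpl_regular:
  assumes "\<forall>b\<in>set ms. b \<notin> {0<..<1}"
  shows "continuous_on {0<..<1} (hpl ms) \<and> (\<exists>C. hpl_dominated ms C)"
  using assms
proof (induction ms)
  case Nil
  \<comment> \<open>The constant function 1 is the logarithmic bound with exponent 0, whose constant
    is \<open>2 ^ 0\<close>.\<close>
  have "hpl_dominated [] 1"
    unfolding hpl_dominated_def using abs_ln_power_le[of _ 0] by simp
  then show ?case by auto
next
  case (Cons m ms)
  then obtain C where C: "hpl_dominated ms C" and co: "continuous_on {0<..<1} (hpl ms)" by auto
  have m: "m \<notin> {0<..<1}" using Cons.prems by simp
  have "continuous_on {0<..<1} (hpl (m # ms))"
    using hpl_Cons_derivative_aux[OF m C co]
    by (meson DERIV_isCont continuous_at_imp_continuous_on)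
  moreover have "\<exists>D. hpl_dominated (m # ms) D"
  proof (cases "\<forall>b\<in>set (m # ms). b = 0")
    case True
    have "hpl_dominated (m # ms) (2 ^ Suc (length ms))"
      unfolding hpl_dominated_def hpl_Cons_all_zero(1)[OF True]
      using True abs_ln_power_le[of _ "Suc (length ms)"] by auto
    then show ?thesis ..
  next
    case False
    then have nz: "\<exists>b\<in>set (m # ms). b \<noteq> 0" by blast
    \<comment> \<open>The factor 2 stems from the antiderivative of the majorant, the rest from the
      bound on the integrand.\<close>
    have "hpl_dominated (m # ms) (2 * ((1 + 1 / \<bar>m\<bar>) * C))"
    proof (rule hpl_dominatedI)
      show "2 * ((1 + 1 / \<bar>m\<bar>) * C) \<ge> 0" using C by (simp add: hpl_dominated_def)
      show "\<bar>hpl (m # ms) x\<bar> \<le> 2 * ((1 + 1 / \<bar>m\<bar>) * C) * sqrt x / sqrt (1 - x)"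
        if "x \<in> {0<..<1}" for x
        unfolding hpl_Cons_not_all_zero[OF nz]
        by (intro integral_from_zero(2)[OF _ hpl_integrand_bound[OF C nz m]] that
            continuous_on_mult continuous_on_hpl_kernel co m)
    qed
    then show ?thesis ..
  qed
  ultimately show ?case ..
qed

lemma continuous_on_hpl:
  assumes "\<forall>b\<in>set ms. b \<notin> {0<..<1}"
  shows "continuous_on {0<..<1} (hpl ms)"
  using hpl_regular[OF assms] ..

lemma hpl_dominated_ex:
  assumes "\<forall>b\<in>set ms. b \<notin> {0<..<1}"
  obtains C where "hpl_dominated ms C"
  using hpl_regular[OF assms] by blast

section \<open>Derivative, limit at 1 and integrability\<close>

lemma has_real_derivative_hpl_Cons:
  assumes "\<forall>b\<in>set (m # ms). b \<notin> {0<..<1}" "x \<in> {0<..<1}"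
  shows "(hpl (m # ms) has_real_derivative hpl_kernel m x * hpl ms x) (at x)"
  using assms hpl_dominated_ex[of ms] continuous_on_hpl[of ms]
  by (metis hpl_Cons_derivative_aux list.set_intros)

text \<open>For \<open>a \<noteq> 1\<close> the kernel adds no singularity at 1, so the integrand
  stays below the arcsine majorant up to a constant. For \<open>a = 1\<close> the limit can be
  infinite, as for \<open>- ln (1 - x)\<close>.\<close>

lemma hpl_tendsto_at_left_1:
  assumes ms: "\<forall>b\<in>set (a # ms). b \<notin> {0<..<1}" and a: "a \<noteq> 1"
  shows "(hpl (a # ms) \<longlongrightarrow> hpl_at_1 (a # ms)) (at_left 1)"
proof -
  have "\<exists>l. (hpl (a # ms) \<longlongrightarrow> l) (at_left 1)"
  proof (cases "\<forall>b\<in>set (a # ms). b = 0")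
    case True
    show ?thesis
      unfolding hpl_Cons_all_zero(1)[OF True]
      by (rule exI[of _ "ln 1 ^ Suc (length ms) / fact (Suc (length ms))"], intro tendsto_intros) auto
  next
    case False
    then have nz: "\<exists>b\<in>set (a # ms). b \<noteq> 0" by blast
    obtain C where C: "hpl_dominated ms C" using hpl_dominated_ex[of ms] ms by auto
    have co: "continuous_on {0<..<1} (\<lambda>y. hpl_kernel a y * hpl ms y)"
      using ms by (auto intro!: continuous_on_mult continuous_on_hpl_kernel continuous_on_hpl)
    have "\<exists>D. \<forall>y\<in>{0<..<1}. \<bar>hpl_kernel a y * hpl ms y\<bar> \<le> D / (sqrt y * sqrt (1 - y))"
    proof (cases "a = 0")
      case True
      then have "\<exists>b\<in>set ms. b \<noteq> 0" using nz by simp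
      then show ?thesis using hpl_integrand_zero_bound[OF C] True by blast
    next
      case a0: False
      have "\<bar>hpl_kernel a y\<bar> * \<bar>hpl ms y\<bar> \<le> (1 / \<bar>a\<bar> + 1 / \<bar>a - 1\<bar>) * (C / (sqrt y * sqrt (1 - y)))"
        if "y \<in> {0<..<1}" for y
        using abs_hpl_kernel_le_const[OF a0 a _ that] ms C that
        by (intro mult_mono) (auto simp: hpl_dominated_def)
      then show ?thesis
        by (intro exI[of _ "(1 / \<bar>a\<bar> + 1 / \<bar>a - 1\<bar>) * C"]) (simp add: abs_mult)
    qed
    then show ?thesis
      unfolding hpl_Cons_not_all_zero[OF nz]
      using integral_from_zero_tendsto_at_left_1[OF co] by blast
  qed
  then show ?thesis
    unfolding hpl_at_1_def using tendsto_Lim trivial_limit_at_left_real by metis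
qed

lemma set_integrable_hpl:
  assumes "\<forall>b\<in>set ms. b \<notin> {0<..<1}"
  shows "set_integrable lborel {0<..<1} (\<lambda>x. x ^ i * hpl ms x)"
proof -
  obtain C where C: "hpl_dominated ms C" using hpl_dominated_ex[OF assms] .
  show ?thesis
  proof (rule set_integrable_Ioo_bound[OF set_integrable_mult_right[OF arcsine_kernel_integrable, of C]])
    show "continuous_on {0<..<1} (\<lambda>x. x ^ i * hpl ms x)"
      using continuous_on_hpl[OF assms] by (intro continuous_intros)
    fix x :: real assume x: "x \<in> {0<..<1}"
    have "\<bar>x ^ i * hpl ms x\<bar> \<le> 1 * \<bar>hpl ms x\<bar>"
      unfolding abs_mult using x by (intro mult_right_mono) (auto simp: power_abs power_le_one)
    then show "\<bar>x ^ i * hpl ms x\<bar> \<le> C * (1 / (sqrt x * sqrt (1 - x)))"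
      using C x by (force simp: hpl_dominated_def)
  qed
qed

section \<open>Mellin transforms and integration by parts\<close>

lemma mellin_finite_hpl:
  assumes "\<forall>b\<in>set ms. b \<notin> {0<..<1}"
  shows "mellin_finite (hpl ms) i"
  using set_integrable_hpl[OF assms]
  by (simp add: mellin_finite_def interval_lebesgue_integrable_def zero_ereal_def one_ereal_def)

lemma mellin_eq: "mellin h i = (LINT x:{0<..<1}|lborel. x ^ i * h x)"
  unfolding mellin_def using lborel_interval_Ioo[of 1] by (simp add: one_ereal_def)

lemma
  fixes f :: "'i \<Rightarrow> real \<Rightarrow> real"
  assumes "\<And>i. i \<in> I \<Longrightarrow> set_integrable M A (f i)"
  shows set_integrable_sum: "set_integrable M A (\<lambda>x. \<Sum>i\<in>I. f i x)"
    and set_integral_sum: "(LINT x:A|M. \<Sum>i\<in>I. f i x) = (\<Sum>i\<in>I. LINT x:A|M. f i x)"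
  using assms unfolding set_integrable_def set_lebesgue_integral_def
  by (simp_all add: sum_distrib_left Bochner_Integration.integral_sum)

text \<open>With \<open>0 ^ 0 = 1\<close> the sum reduces to \<open>x ^ n\<close> for \<open>a = 0\<close>, so one identity serves every case.\<close>

lemma power_diff_times_hpl_kernel:
  assumes "a \<notin> {0<..<1}" "x \<in> {0<..<1}"
  shows "(x ^ Suc n - a ^ Suc n) * hpl_kernel a x =
    (if a > 0 then -1 else 1) * (\<Sum>i\<le>n. a ^ (n - i) * x ^ i)"
proof -
  \<comment> \<open>The kernel is \<open>1 / (a - x)\<close> for \<open>a > 0\<close> and
    \<open>1 / (x - a)\<close> for \<open>a \<le> 0\<close>, zero included.\<close>
  have "(x - a) * hpl_kernel a x = (if a > 0 then -1 else 1)"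
  proof (cases "a > 0")
    case True
    then have "a - x \<noteq> 0" using assms by auto
    then show ?thesis using True by (simp add: hpl_kernel_def field_simps)
  next
    case False
    then have "x - a \<noteq> 0" using assms by auto
    then show ?thesis using False assms by (cases "a = 0") (simp_all add: hpl_kernel_def field_simps)
  qed
  moreover have "x ^ Suc n - a ^ Suc n = (x - a) * (\<Sum>i\<le>n. a ^ (n - i) * x ^ i)"
    using power_diff_sumr2[of x "Suc n" a] by (simp add: lessThan_Suc_atMost)
  ultimately show ?thesis by (simp add: mult.assoc mult.commute mult.left_commute)
qed

text \<open>If \<open>a \<noteq> 0\<close>, the polylogarithm itself decays like
  \<open>sqrt x\<close>. If \<open>a = 0\<close>, all indices may vanish and only growth like
  \<open>1 / sqrt x\<close> is known, but the factor \<open>x ^ Suc n \<le> x\<close>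
  compensates.\<close>

lemma boundary_term_at_0:
  assumes ms: "\<forall>b\<in>set (a # ms). b \<notin> {0<..<1}"
  shows "((\<lambda>x. (x ^ Suc n - a ^ Suc n) * hpl (a # ms) x) \<longlongrightarrow> 0) (at_right 0)"
proof -
  obtain C where C: "hpl_dominated (a # ms) C" using hpl_dominated_ex[OF ms] .
  have ev: "eventually (\<lambda>x::real. x \<in> {0<..<1}) (at_right 0)"
    by (rule eventually_at_rightI[of 0 1]) auto
  \<comment> \<open>For \<open>a = 0\<close> this is just \<open>C\<close>; otherwise the second
    factor bounds the polynomial by the triangle inequality.\<close>
  define D where "D = C * (1 + \<bar>a\<bar> ^ Suc n)"
  have "\<bar>(x ^ Suc n - a ^ Suc n) * hpl (a # ms) x\<bar> \<le> D * (sqrt x / sqrt (1 - x))"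
    if x: "x \<in> {0<..<1}" for x
  proof (cases "a = 0")
    case True
    have "\<bar>x ^ Suc n\<bar> * \<bar>hpl (a # ms) x\<bar> \<le> x * (C / (sqrt x * sqrt (1 - x)))"
      using C x by (intro mult_mono) (auto simp: hpl_dominated_def power_le_one mult_left_le abs_mult power_abs)
    also have "\<dots> = C * (sqrt x / sqrt (1 - x))" using x by (simp add: field_simps)
    finally show ?thesis using True by (simp add: abs_mult D_def)
  next
    case False
    have "\<bar>x ^ Suc n - a ^ Suc n\<bar> \<le> \<bar>x ^ Suc n\<bar> + \<bar>a ^ Suc n\<bar>" by (rule abs_triangle_ineq4)
    also have "\<dots> \<le> 1 + \<bar>a\<bar> ^ Suc n"
      unfolding power_abs using x by (intro add_right_mono power_le_one) auto
    finally have "\<bar>x ^ Suc n - a ^ Suc n\<bar> * \<bar>hpl (a # ms) x\<bar> \<le> (1 + \<bar>a\<bar> ^ Suc n) * (C * sqrt x / sqrt (1 - x))"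
      using C x False by (intro mult_mono) (auto simp: hpl_dominated_def)
    then show ?thesis by (simp add: abs_mult D_def mult_ac)
  qed
  then have "eventually (\<lambda>x. norm ((x ^ Suc n - a ^ Suc n) * hpl (a # ms) x) \<le> D * (sqrt x / sqrt (1 - x))) (at_right 0)"
    using ev by (auto elim!: eventually_mono simp del: power_Suc hpl.simps)
  moreover have "((\<lambda>x::real. D * (sqrt x / sqrt (1 - x))) \<longlongrightarrow> 0) (at_right 0)"
    by (auto intro!: tendsto_eq_intros)
  ultimately show ?thesis by (rule Lim_null_comparison)
qed

text \<open>For \<open>a = 1\<close> the constant \<open>hpl_at_1\<close> may be unspecified, but
  its coefficient is 0. The true limit is 0 as well, since the simple zero of the polynomial at 1
  beats growth of order \<open>1 / sqrt (1 - x)\<close>.\<close>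

lemma boundary_term_at_1:
  assumes ms: "\<forall>b\<in>set (a # ms). b \<notin> {0<..<1}"
  shows "((\<lambda>x. (x ^ Suc n - a ^ Suc n) * hpl (a # ms) x) \<longlongrightarrow>
           (1 - a ^ Suc n) * hpl_at_1 (a # ms)) (at_left 1)"
proof (cases "a = 1")
  case False
  then show ?thesis
    by (auto intro!: tendsto_eq_intros hpl_tendsto_at_left_1[OF ms] simp del: hpl.simps)
next
  case True
  obtain C where C: "hpl_dominated (a # ms) C" using hpl_dominated_ex[OF ms] .
  have ev: "eventually (\<lambda>x::real. x \<in> {0<..<1}) (at_left 1)"
    by (rule eventually_at_leftI[of 0]) auto
  let ?S = "\<lambda>x::real. \<Sum>i\<le>n. 1 ^ (n - i) * x ^ i"
  have "\<bar>(x ^ Suc n - a ^ Suc n) * hpl (a # ms) x\<bar> \<le> (C * sqrt x * ?S x) * sqrt (1 - x)"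
    if x: "x \<in> {0<..<1}" for x
  proof -
    have S: "?S x \<ge> 0" using x by (intro sum_nonneg) auto
    have "x ^ Suc n - a ^ Suc n = (x - 1) * ?S x"
      using power_diff_sumr2[of x "Suc n" 1] True by (simp add: lessThan_Suc_atMost)
    then have "\<bar>(x ^ Suc n - a ^ Suc n) * hpl (a # ms) x\<bar> = (1 - x) * ?S x * \<bar>hpl (a # ms) x\<bar>"
      using x S by (simp add: abs_mult del: hpl.simps)
    also have "\<dots> \<le> (1 - x) * ?S x * (C * sqrt x / sqrt (1 - x))"
      using x S C True by (intro mult_left_mono) (auto simp: hpl_dominated_def simp del: hpl.simps)
    also have "\<dots> = (C * sqrt x * ?S x) * ((1 - x) / sqrt (1 - x))" by simp
    also have "(1 - x) / sqrt (1 - x) = sqrt (1 - x)" using x by (simp add: real_div_sqrt)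
    finally show ?thesis .
  qed
  then have "eventually (\<lambda>x. norm ((x ^ Suc n - a ^ Suc n) * hpl (a # ms) x) \<le>
      (C * sqrt x * ?S x) * sqrt (1 - x)) (at_left 1)"
    using ev by (auto elim!: eventually_mono simp del: power_Suc hpl.simps)
  moreover have "((\<lambda>x::real. (C * sqrt x * ?S x) * sqrt (1 - x)) \<longlongrightarrow> 0) (at_left 1)"
    by (rule tendsto_eq_intros refl | simp)+
  ultimately have "((\<lambda>x. (x ^ Suc n - a ^ Suc n) * hpl (a # ms) x) \<longlongrightarrow> 0) (at_left 1)"
    by (rule Lim_null_comparison)
  then show ?thesis using True by simp
qed

text \<open>Both sides are the integral over the unit interval of the derivative of
  \<open>(x ^ Suc n - a ^ Suc n) * hpl (a # ms) x\<close>: the left by the product rule, the right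
  by the boundary terms.\<close>

lemma mellin_hpl_Cons:
  fixes n :: nat
  assumes ms: "\<forall>b\<in>set (a # ms). b \<notin> {0<..<1}"
  defines "s \<equiv> if a > 0 then -1 else 1"
  shows "real (n + 1) * mellin (hpl (a # ms)) n + s * (\<Sum>i\<le>n. a ^ (n - i) * mellin (hpl ms) i) =
    (1 - a ^ (n + 1)) * hpl_at_1 (a # ms)"
proof -
  define N where "N = real (n + 1)"
  let ?F = "\<lambda>x. (x ^ Suc n - a ^ Suc n) * hpl (a # ms) x"
  let ?f1 = "\<lambda>x. N * (x ^ n * hpl (a # ms) x)"
  let ?f2 = "\<lambda>x. s * (\<Sum>i\<le>n. a ^ (n - i) * (x ^ i * hpl ms x))"
  let ?f = "\<lambda>x. ?f1 x + ?f2 x"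
  have ms': "\<forall>b\<in>set ms. b \<notin> {0<..<1}" and a: "a \<notin> {0<..<1}" using ms by auto
  have D: "(?F has_real_derivative ?f x) (at x)" if x: "x \<in> {0<..<1}" for x
  proof -
    have "(?F has_real_derivative N * x ^ n * hpl (a # ms) x +
        hpl_kernel a x * hpl ms x * (x ^ Suc n - a ^ Suc n)) (at x)"
      by (rule derivative_eq_intros has_real_derivative_hpl_Cons[OF ms x] refl)+ (simp add: N_def)
    \<comment> \<open>The polynomial cancels the pole of the kernel, leaving a combination of
      integrable functions \<open>x ^ i * hpl ms x\<close>.\<close>
    moreover have "hpl_kernel a x * hpl ms x * (x ^ Suc n - a ^ Suc n) = ?f2 x"
    proof -
      have "hpl_kernel a x * hpl ms x * (x ^ Suc n - a ^ Suc n) =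
          ((x ^ Suc n - a ^ Suc n) * hpl_kernel a x) * hpl ms x" by (simp only: mult_ac)
      also have "\<dots> = ?f2 x"
        unfolding power_diff_times_hpl_kernel[OF a x] s_def by (simp add: sum_distrib_right mult.assoc)
      finally show ?thesis .
    qed
    ultimately show ?thesis by (simp only: mult.assoc)
  qed
  have co: "continuous_on {0<..<1} ?f"
    by (intro continuous_intros continuous_on_hpl ms ms')
  have i1: "set_integrable lborel {0<..<1} ?f1"
    by (intro set_integrable_mult_right set_integrable_hpl ms)
  have i2': "set_integrable lborel {0<..<1} (\<lambda>x. a ^ (n - i) * (x ^ i * hpl ms x))" for i
    by (intro set_integrable_mult_right set_integrable_hpl ms')
  have i2: "set_integrable lborel {0<..<1} ?f2"
    by (intro set_integrable_mult_right set_integrable_sum set_integrable_hpl ms')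
  \<comment> \<open>This form of the fundamental theorem uses only one-sided limits of
    \<open>?F\<close> at the endpoints, so its values there never enter.\<close>
  have "(LBINT x=ereal 0..ereal 1. ?f x) = (1 - a ^ Suc n) * hpl_at_1 (a # ms) - 0"
  proof (rule interval_integral_FTC_integrable)
    show "((?F \<circ> real_of_ereal) \<longlongrightarrow> 0) (at_right (ereal 0))"
      unfolding ereal_tendsto_simps by (rule boundary_term_at_0[OF ms])
    show "((?F \<circ> real_of_ereal) \<longlongrightarrow> (1 - a ^ Suc n) * hpl_at_1 (a # ms)) (at_left (ereal 1))"
      unfolding ereal_tendsto_simps by (rule boundary_term_at_1[OF ms])
    show "set_integrable lborel (einterval (ereal 0) (ereal 1)) ?f"
      unfolding einterval_eq using i1 i2 by (rule set_integral_add)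
    show "(?F has_vector_derivative ?f x) (at x)" if "ereal 0 < ereal x" "ereal x < ereal 1" for x
      using D that unfolding has_real_derivative_iff_has_vector_derivative by simp
    show "isCont ?f x" if "ereal 0 < ereal x" "ereal x < ereal 1" for x
      using co that continuous_on_eq_continuous_at[of "{0<..<1::real}" ?f] by simp
  qed simp
  moreover have "(LBINT x=ereal 0..ereal 1. ?f x) = (LINT x:{0<..<1}|lborel. ?f x)"
    by (simp add: interval_integral_Ioo del: hpl.simps)
  moreover have "\<dots> = (LINT x:{0<..<1}|lborel. ?f1 x) + (LINT x:{0<..<1}|lborel. ?f2 x)"
    using i1 i2 by (rule set_integral_add)
  moreover have "\<dots> = N * mellin (hpl (a # ms)) n + s * (\<Sum>i\<le>n. a ^ (n - i) * mellin (hpl ms) i)"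
    unfolding set_integral_mult_right set_integral_sum[OF i2'] mellin_eq ..
  ultimately show ?thesis by (simp add: N_def del: hpl.simps)
qed

section \<open>The four cases of the leading index\<close>

theorem lemma7p4:
  fixes n :: nat and a :: real and ms :: "real list"
  assumes "n \<ge> 1"
    and "a \<notin> {0<..<1}"
    and "ms \<noteq> []"
    and "\<forall>b \<in> set ms. b \<notin> {0<..<1}"
  shows "(a < 0 \<longrightarrow> mellin (hpl (a # ms)) n =
            (1 - a ^ (n + 1)) * hpl_at_1 (a # ms) / real (n + 1)
            - a ^ n / real (n + 1) * (\<Sum>i=0..n. mellin (hpl ms) i / a ^ i))
       \<and> (a = 0 \<longrightarrow> mellin (hpl (a # ms)) n =
            hpl_at_1 (0 # ms) / real (n + 1) - 1 / real (n + 1) * mellin (hpl ms) n)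
       \<and> (a = 1 \<longrightarrow> mellin (hpl (a # ms)) n =
            1 / real (n + 1) * (\<Sum>i=0..n. mellin (hpl ms) i))
       \<and> (a > 1 \<longrightarrow> mellin (hpl (a # ms)) n =
            (1 - a ^ (n + 1)) * hpl_at_1 (a # ms) / real (n + 1)
            + a ^ n / real (n + 1) * (\<Sum>i=0..n. mellin (hpl ms) i / a ^ i))
       \<and> (a \<noteq> 1 \<longrightarrow> hpl_at_1_finite (a # ms))
       \<and> mellin_finite (hpl (a # ms)) n
       \<and> (\<forall>i \<in> {0..n}. mellin_finite (hpl ms) i)"
proof -
  define N where "N = real (n + 1)"
  define S where "S = (\<Sum>i\<le>n. a ^ (n - i) * mellin (hpl ms) i)"
  have N: "N > 0" by (simp add: N_def)
  have ams: "\<forall>b\<in>set (a # ms). b \<notin> {0<..<1}" using assms by auto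
  have "N * mellin (hpl (a # ms)) n + (if a > 0 then -1 else 1) * S =
      (1 - a ^ (n + 1)) * hpl_at_1 (a # ms)"
    using mellin_hpl_Cons[OF ams, of n] by (simp only: N_def S_def)
  \<comment> \<open>At \<open>a = 1\<close> the coefficient of \<open>hpl_at_1\<close> vanishes, so
    the possibly unspecified constant drops out.\<close>
  then have main: "mellin (hpl (a # ms)) n =
      (1 - a ^ (n + 1)) * hpl_at_1 (a # ms) / N + (if a > 0 then 1 else -1) * S / N"
    using N by (auto simp: field_simps simp del: hpl.simps split: if_splits)
  have S: "S = a ^ n * (\<Sum>i=0..n. mellin (hpl ms) i / a ^ i)" if "a \<noteq> 0"
    unfolding S_def sum_distrib_left using that
    by (auto intro!: sum.cong simp: power_diff atLeast0AtMost)
  \<comment> \<open>Since \<open>0 ^ 0 = 1\<close>, only the summand \<open>i = n\<close>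
    survives.\<close>
  have S0: "S = mellin (hpl ms) n" if "a = 0"
  proof -
    have "S = (\<Sum>i\<le>n. if i = n then mellin (hpl ms) i else 0)"
      unfolding S_def using that by (intro sum.cong) (auto simp: power_0_left)
    then show ?thesis by simp
  qed
  have "hpl_at_1_finite (a # ms)" if "a \<noteq> 1"
    using hpl_tendsto_at_left_1[OF ams that] by (auto simp: hpl_at_1_finite_def)
  then show ?thesis
    unfolding N_def[symmetric]
    using main S S0 mellin_finite_hpl[OF ams] mellin_finite_hpl[OF assms(4)]
    by (auto simp del: hpl.simps)
qed

end
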